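(* There exist half-integral polytopes of arbitrarily large dimension $d$ whose expansion is less than $d/(\sqrt{2})^{d}$. That is, for every positive integer $N$ there exist an integer $d\geq N$ and a $d$-dimensional half-integral polytope $P\subset\mathbb{R}^d$ such that the expansion $h(P)$ of $P$ satisfies $$h(P)<\frac{d}{(\sqrt{2})^{d}}.$$
   Context: A polytope is the convex hull of a finite subset of $\mathbb{R}^d$. A polytope in $\mathbb{R}^d$ is called half-integral if all its vertices belong to $\{0,1/2,1\}^d$. The graph of a polytope $P$ is the graph formed by the vertices and the edges (one-dimensional faces) of $P$. The expansion (edge expansion, Cheeger constant) of a finite graph $G$ with vertex set $V$ is $$h(G)=\min\left\{\frac{|\partial S|}{\min\{|S|,|V\setminus S|\}} : S\subset V,\ S\neq\emptyset,\ S\neq V\right\},$$ where $\partial S$ is the set of the edges of $G$ with one vertex in $S$ and the other in $V\setminus S$. The expansion $h(P)$ of a polytope $P$ is the expansion of its graph. *)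

theory Defs
  imports "HOL-Analysis.Analysis" "HOL-Analysis.Finite_Function_Topology"
begin

text \<open>
  The dimension \<open>d\<close> is existentially quantified, so it cannot be a type.  The space
  of \<open>d\<close>-tuples of reals is therefore the subspace of finitely supported
  sequences that are supported on the coordinates \<open>0, ..., d - 1\<close>.  The type
  \<^typ>\<open>nat \<Rightarrow>\<^sub>0 real\<close> is a real vector space, so \<^const>\<open>polytope\<close>,
  \<^const>\<open>extreme_point_of\<close> and \<^const>\<open>face_of\<close> apply to its subsets as they are.
\<close>

definition coord_space :: "nat \<Rightarrow> (nat \<Rightarrow>\<^sub>0 real) set" where
  "coord_space d = {x. Poly_Mapping.keys x \<subseteq> {..<d}}"

text \<open>
  \<^const>\<open>aff_dim\<close>, and hence \<^const>\<open>edge_of\<close>, is restricted to the class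
  \<^class>\<open>euclidean_space\<close>, of which \<^typ>\<open>nat \<Rightarrow>\<^sub>0 real\<close> is not an instance.  This is
  its definition for arbitrary real vector spaces; the value is unspecified if the affine
  hull of the set is infinite-dimensional.
\<close>

definition affine_dim :: "'a::real_vector set \<Rightarrow> int" where
  "affine_dim S = (SOME d :: int.
     \<exists>B. finite B \<and> affine hull B = affine hull S \<and> \<not> affine_dependent B
       \<and> of_nat (card B) = d + 1)"

lemma affine_dim_eq_aff_dim: "affine_dim S = aff_dim S" for S :: "'a::euclidean_space set"
proof -
  have "(finite B \<and> affine hull B = affine hull S \<and> \<not> affine_dependent B \<and> Q) \<longleftrightarrow>
        (affine hull B = affine hull S \<and> \<not> affine_dependent B \<and> Q)" for B Q
    using aff_independent_finite by blast
  then show ?thesis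
    by (simp add: affine_dim_def aff_dim_def)
qed

definition half_integral_polytope :: "nat \<Rightarrow> (nat \<Rightarrow>\<^sub>0 real) set \<Rightarrow> bool" where
  "half_integral_polytope d P \<longleftrightarrow>
     polytope P \<and> P \<subseteq> coord_space d \<and>
     (\<forall>v. v extreme_point_of P \<longrightarrow> (\<forall>i<d. Poly_Mapping.lookup v i \<in> {0, 1/2, 1}))"

definition polytope_verts :: "'a::real_vector set \<Rightarrow> 'a set" where
  "polytope_verts P = {v. v extreme_point_of P}"

definition polytope_edges :: "'a::real_vector set \<Rightarrow> 'a set set" where
  "polytope_edges P =
     {{u, v} | u v. u \<in> polytope_verts P \<and> v \<in> polytope_verts P \<and> u \<noteq> v \<and>
        (\<exists>F. F face_of P \<and> affine_dim F = 1 \<and> u \<in> F \<and> v \<in> F)}"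

definition edge_boundary :: "'a set \<Rightarrow> 'a set set \<Rightarrow> 'a set \<Rightarrow> 'a set set" where
  "edge_boundary V E S = {e \<in> E. \<exists>u\<in>S. \<exists>v\<in>V - S. e = {u, v}}"

text \<open>Meaningful for a finite vertex set with at least two elements.\<close>

definition graph_expansion :: "'a set \<Rightarrow> 'a set set \<Rightarrow> real" where
  "graph_expansion V E =
     Min {real (card (edge_boundary V E S)) / real (min (card S) (card (V - S))) | S.
          S \<subseteq> V \<and> S \<noteq> {} \<and> S \<noteq> V}"

definition polytope_expansion :: "'a::real_vector set \<Rightarrow> real" where
  "polytope_expansion P = graph_expansion (polytope_verts P) (polytope_edges P)"

end

theory Submission
  imports Defs
begin

text \<open>
  The polytope \<open>P\<close> in dimension \<open>d = n + 2\<close> has two very large sets of vertices that are joined only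
  through a narrow middle part.  It projects onto a hexagon in the plane of the last two coordinates,
  with corners, in cyclic order,
  \<open>(0, 0)\<close>, \<open>(1/2, 0)\<close>, \<open>(1, 1/2)\<close>, \<open>(1, 1)\<close>, \<open>(1/2, 1)\<close>, \<open>(0, 1/2)\<close>,
  and all its vertices lie over these corners.  Over \<open>(0, 0)\<close> and \<open>(1, 1)\<close> they are the points of
  \<open>{0, 1/2, 1}\<^sup>n\<close> with exactly \<open>k\<close> coordinates different from \<open>1/2\<close>.  These lie on a sphere, hence are
  in convex position, and for a suitable \<open>k\<close> there are at least \<open>3\<^sup>n / (n + 1)\<close> of them
  (\<open>exists_large_sphere\<close>).  Over the other four corners the vertices are the \<open>2\<^sup>n\<close> points of
  \<open>{0, 1}\<^sup>n\<close>.

  Cut \<open>P\<close> by the hyperplane on which the last two coordinates add up to \<open>1\<close>.  It contains no vertex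
  and crosses two opposite edges of the hexagon, the bridges, whose ends carry cubes.  All fibres lie in the
  unit cube, so the section is the product of that cube and a segment (\<open>middle_section_subset\<close>),
  and it has only \<open>2 * 2\<^sup>n\<close> vertices: the midpoints of the segments that join equal cube vertices over the ends
  of a bridge.  An edge of \<open>P\<close> that crosses the hyperplane meets it in a point of the section.  Being a
  face, the edge contains one of these midpoints and with it the ends of the corresponding segment,
  which are vertices; so the edge is that segment (\<open>crossing_edge_is_bridge\<close>).  Thus at
  most \<open>2 * 2\<^sup>n\<close> edges cross the cut, while each side has at least \<open>3\<^sup>n / (n + 1)\<close> vertices, and the expansion is at most \<open>2 * (n + 1) * (2 / 3)\<^sup>n\<close>.  As
  \<open>2 / 3 < 1 / sqrt 2\<close>, this is below \<open>d / (sqrt 2)\<^sup>d\<close> for large \<open>n\<close>.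
\<close>

section \<open>Affine dimension in real vector spaces\<close>

lemma affine_hull_eq_direction_subset:
  fixes a b :: "'a::real_vector"
  assumes "(+) a ` L = (+) b ` M" "subspace L" "subspace M"
  shows "L \<subseteq> M"
proof
  fix x assume "x \<in> L"
  then obtain y where y: "y \<in> M" "a + x = b + y"
    using assms(1) by (metis (no_types, lifting) imageE imageI)
  obtain z where z: "z \<in> M" "a + 0 = b + z"
    using assms(1) subspace_0[OF assms(2)] by (metis (no_types, lifting) imageE imageI)
  have "x = y - z" using y(2) z(2) by (simp add: algebra_simps)
  then show "x \<in> M" using y(1) z(1) assms(3) by (simp add: subspace_diff)
qed

text \<open>
  The common affine hull has a single direction space, and removing one point from either set and
  translating it to the origin leaves a basis of that space.
\<close>
lemma affine_independent_same_hull_card_eq: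
  fixes B C :: "'a::real_vector set"
  assumes "finite B" "finite C" "\<not> affine_dependent B" "\<not> affine_dependent C"
    and hull: "affine hull B = affine hull C"
  shows "card B = card C"
proof (cases "B = {}")
  case True
  then show ?thesis using hull by (metis affine_hull_eq_empty)
next
  case False
  then have "C \<noteq> {}" using hull by (metis affine_hull_eq_empty)
  with False obtain a b where a: "a \<in> B" and b: "b \<in> C" by blast
  let ?L = "(\<lambda>x. -a + x) ` (B - {a})" and ?M = "(\<lambda>x. -b + x) ` (C - {b})"
  have ind: "independent ?L" "independent ?M"
    using assms(3,4) a b affine_dependent_iff_dependent2 by blast+
  have eq: "(+) a ` span ?L = (+) b ` span ?M"
    using hull affine_hull_span2[OF a] affine_hull_span2[OF b] by simp
  have "span ?L = span ?M"
    using affine_hull_eq_direction_subset[OF eq] affine_hull_eq_direction_subset[OF eq[symmetric]]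
    by (simp add: subset_antisym)
  then have "card ?L = card ?M"
    using dim_eq_card ind by metis
  then have "card (B - {a}) = card (C - {b})"
    by (simp add: card_image)
  then show ?thesis using a b assms(1,2)
    by (metis card_Suc_Diff1)
qed

text \<open>
  Every affine basis with the same hull has the same size, so the choice in the definition of
  \<^const>\<open>affine_dim\<close> is forced as soon as one finite affine basis exists.
\<close>
lemma affine_dim_eqI:
  fixes S :: "'a::real_vector set"
  assumes "finite B" "affine hull B = affine hull S" "\<not> affine_dependent B"
  shows "affine_dim S = int (card B) - 1"
  unfolding affine_dim_def
proof (rule some_equality)
  show "\<exists>B'. finite B' \<and> affine hull B' = affine hull S \<and> \<not> affine_dependent B'
      \<and> of_nat (card B') = int (card B) - 1 + 1"
    using assms by auto
next
  fix d :: int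
  assume "\<exists>B'. finite B' \<and> affine hull B' = affine hull S \<and> \<not> affine_dependent B' \<and> of_nat (card B') = d + 1"
  then obtain B' where "finite B'" "affine hull B' = affine hull S" "\<not> affine_dependent B'" "int (card B') = d + 1"
    by auto
  moreover from this have "card B' = card B"
    using assms affine_independent_same_hull_card_eq[of B' B] by simp
  ultimately show "d = int (card B) - 1" by simp
qed

text \<open>
  The assumption \<open>S \<subseteq> span T\<close> with \<open>T\<close> finite provides a finite affine basis of \<open>S\<close>; without one
  the value of \<^const>\<open>affine_dim\<close> would carry no information.
\<close>
lemma affine_dim_one_subset_line:
  fixes S :: "'a::real_vector set"
  assumes "S \<subseteq> span T" "finite T" "S \<noteq> {}" "affine_dim S = 1"
  obtains a b where "S \<subseteq> affine hull {a, b}"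
proof -
  obtain x where "x \<in> S" using assms(3) by auto
  then obtain B where B: "\<not> affine_dependent B" "B \<subseteq> S" "affine hull B = affine hull S" "x \<in> B"
    using extend_to_affine_basis_nonempty[of "{x}" S] by (metis affine_independent_1 empty_not_insert empty_subsetI insert_subset)
  have ind: "independent ((\<lambda>y. -x + y) ` (B - {x}))"
    using B affine_dependent_iff_dependent2 by blast
  have "(\<lambda>y. -x + y) ` (B - {x}) \<subseteq> span T"
    using B(2,4) assms(1) by (auto intro!: span_diff simp: subset_iff)
  then have "finite ((\<lambda>y. -x + y) ` (B - {x}))"
    using independent_span_bound[OF assms(2) ind] by auto
  then have "finite (B - {x})" by (rule finite_imageD) auto
  then have fin: "finite B" by simp
  then have "card B = 2" using affine_dim_eqI[OF fin B(3,1)] assms(4) by simp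
  then obtain a b where "B = {a, b}" by (auto simp: card_2_iff)
  then show ?thesis using that[of a b] B(3) hull_subset[of S affine] by simp
qed

section \<open>Extreme points and faces\<close>

text \<open>
  Of three distinct points on a line one lies strictly between the other two, so it is not extreme.
\<close>
lemma extreme_points_on_line:
  fixes x y z :: "'a::real_vector"
  assumes line: "{x, y, z} \<subseteq> affine hull {a, b}"
    and ext: "x extreme_point_of P" "y extreme_point_of P" "z extreme_point_of P"
    and ne: "x \<noteq> y"
  shows "z = x \<or> z = y"
proof -
  have par: "\<exists>r. p = a + r *\<^sub>R (b - a)" if "p \<in> {x, y, z}" for p
  proof -
    have "p \<in> affine hull {a, b}" using that line by auto
    then obtain u v where "p = u *\<^sub>R a + v *\<^sub>R b" "u + v = 1"
      by (auto simp: affine_hull_2)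
    moreover from this have "u = 1 - v" by simp
    ultimately have "p = a + v *\<^sub>R (b - a)"
      by (simp add: scaleR_diff_right scaleR_diff_left)
    then show ?thesis by blast
  qed
  have mid: False
    if "q extreme_point_of P" "p \<in> P" "s \<in> P"
      "p = a + r1 *\<^sub>R (b - a)" "q = a + r2 *\<^sub>R (b - a)" "s = a + r3 *\<^sub>R (b - a)"
      "r1 < r2" "r2 < r3" "a \<noteq> b" for p q s r1 r2 r3
  proof -
    define t where "t = (r2 - r1) / (r3 - r1)"
    have t: "0 < t" "t < 1" using that(7,8) by (auto simp: t_def field_simps)
    have "r2 = (1 - t) * r1 + t * r3"
    proof -
      have "t * (r3 - r1) = r2 - r1" using that(7,8) by (simp add: t_def)
      then show ?thesis by (simp add: algebra_simps)
    qed
    moreover have "a + ((1 - t) * r1 + t * r3) *\<^sub>R d = (1 - t) *\<^sub>R (a + r1 *\<^sub>R d) + t *\<^sub>R (a + r3 *\<^sub>R d)" for d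
      by (simp add: algebra_simps)
    ultimately have "q = (1 - t) *\<^sub>R p + t *\<^sub>R s"
      using that(4-6) by simp
    moreover have "p \<noteq> s" using that by auto
    ultimately have "q \<in> open_segment p s" using t by (auto simp: in_segment)
    then show False using that(1-3) by (auto simp: extreme_point_of_def)
  qed
  obtain rx ry rz where r: "x = a + rx *\<^sub>R (b - a)" "y = a + ry *\<^sub>R (b - a)" "z = a + rz *\<^sub>R (b - a)"
    using par[of x] par[of y] par[of z] by auto
  have P: "x \<in> P" "y \<in> P" "z \<in> P" using ext by (auto simp: extreme_point_of_def)
  have ab: "a \<noteq> b" using r ne by auto
  show ?thesis
  proof (rule ccontr)
    assume "\<not> ?thesis"
    then have "rz \<noteq> rx" "rz \<noteq> ry" "rx \<noteq> ry" using r ne by auto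
    then consider "rx < ry" "ry < rz" | "rx < rz" "rz < ry" | "ry < rx" "rx < rz"
      | "ry < rz" "rz < rx" | "rz < rx" "rx < ry" | "rz < ry" "ry < rx" by linarith
    then show False
      by cases (use mid r P ext ab in blast)+
  qed
qed

text \<open>
  The complement of a face in a convex set is convex.  If it contained all of \<open>Q\<close>, it would contain
  the convex hull of \<open>Q\<close>, hence \<open>w\<close>.
\<close>
lemma face_meets_generators:
  assumes "F face_of P" "convex P" "Q \<subseteq> P" "w \<in> F" "w \<in> convex hull Q"
  obtains q where "q \<in> Q" "q \<in> F"
proof -
  have "convex (P - F)"
    unfolding convex_contains_open_segment
  proof (intro ballI subsetI DiffI)
    fix a b x assume ab: "a \<in> P - F" "b \<in> P - F" and x: "x \<in> open_segment a b"
    show "x \<in> P" using ab x assms(2) by (auto simp: convex_contains_open_segment)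
    show "x \<notin> F" using ab x assms(1) by (auto simp: face_of_def)
  qed
  then have "convex hull Q \<subseteq> P - F" if "Q \<inter> F = {}"
    using that assms(3) by (intro hull_minimal) auto
  then show ?thesis using assms(4,5) that by blast
qed

text \<open>
  The set \<open>K\<close> that consists of \<open>x\<close> and the open halfspace \<open>l y < l x\<close> is convex and contains \<open>V\<close>.
  No segment inside \<open>K\<close> has \<open>x\<close> in its relative interior.
\<close>
lemma extreme_point_of_convex_hull_strict_maximum:
  fixes l :: "'a::real_vector \<Rightarrow> real"
  assumes "linear l" "x \<in> V" "\<And>y. y \<in> V \<Longrightarrow> y \<noteq> x \<Longrightarrow> l y < l x"
  shows "x extreme_point_of (convex hull V)"
proof -
  have mid: "l ((1 - u) *\<^sub>R y + u *\<^sub>R z) < l x"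
    if "0 < u" "u < 1" "l y \<le> l x" "l z \<le> l x" "l y < l x \<or> l z < l x" for u y z
  proof -
    have "l ((1 - u) *\<^sub>R y + u *\<^sub>R z) = (1 - u) * l y + u * l z"
      using assms(1) by (simp add: linear_add linear_scale)
    also have "\<dots> < (1 - u) * l x + u * l x"
      using that by (smt (verit, best) mult_left_mono mult_strict_left_mono)
    finally show ?thesis by (simp add: algebra_simps)
  qed
  define K where "K = insert x {y. l y < l x}"
  have "convex K"
    unfolding convex_alt
  proof (intro ballI allI impI)
    fix y z u assume yz: "y \<in> K" "z \<in> K" and u: "0 \<le> (u::real) \<and> u \<le> 1"
    show "(1 - u) *\<^sub>R y + u *\<^sub>R z \<in> K"
    proof (cases "u = 0 \<or> u = 1 \<or> (y = x \<and> z = x)")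
      case True
      have "(1 - u) *\<^sub>R x + u *\<^sub>R x = x" by (simp add: algebra_simps)
      then show ?thesis using True yz by auto
    next
      case False
      then have "0 < u" "u < 1" using u by auto
      then show ?thesis using mid[of u y z] yz False by (auto simp: K_def)
    qed
  qed
  moreover have "V \<subseteq> K" using assms(3) by (auto simp: K_def)
  ultimately have sub: "convex hull V \<subseteq> K" by (rule hull_minimal[rotated])
  have "x \<notin> open_segment y z" if "y \<in> convex hull V" "z \<in> convex hull V" for y z
  proof
    assume "x \<in> open_segment y z"
    then obtain u where "y \<noteq> z" "0 < u" "u < 1" "x = (1 - u) *\<^sub>R y + u *\<^sub>R z"
      by (auto simp: in_segment)
    moreover have "y \<in> K" "z \<in> K" using that sub by auto
    ultimately show False using mid[of u y z] by (auto simp: K_def)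
  qed
  then show ?thesis using assms(2) by (auto simp: extreme_point_of_def hull_inc)
qed

text \<open>
  A one-dimensional face lies on a line, and a line carries at most two extreme points of \<open>P\<close>.
  This recovers an edge from any two vertices found on it.
\<close>
lemma edge_determined_by_extreme_points:
  fixes F P :: "'a::real_vector set"
  assumes "F face_of P" "P \<subseteq> span T" "finite T" "affine_dim F = 1"
    and "u extreme_point_of P" "v extreme_point_of P" "p extreme_point_of P" "p' extreme_point_of P"
    and "{u, v, p, p'} \<subseteq> F" "u \<noteq> v" "p \<noteq> p'"
  shows "{u, v} = {p, p'}"
proof -
  have "F \<subseteq> span T" "F \<noteq> {}" using assms(1,2,9) face_of_imp_subset by auto
  then obtain a b where "F \<subseteq> affine hull {a, b}"
    using affine_dim_one_subset_line assms(3,4) by blast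
  then have "p = u \<or> p = v" "p' = u \<or> p' = v"
    using extreme_points_on_line[of u v p a b P] extreme_points_on_line[of u v p' a b P] assms
    by auto
  then show ?thesis using assms(11) by auto
qed

section \<open>The coordinate space\<close>

lemma lookup_scaleR [simp]:
  "Poly_Mapping.lookup (r *\<^sub>R x) i = r *\<^sub>R Poly_Mapping.lookup x i"
  for x :: "'a \<Rightarrow>\<^sub>0 'b::real_vector"
proof -
  have "finite {i. r *\<^sub>R Poly_Mapping.lookup x i \<noteq> 0}"
    by (rule finite_subset[OF _ finite_keys[of x]]) (auto simp: in_keys_iff)
  then show ?thesis by (simp add: scaleR_poly_mapping_def)
qed

lemma lookup_linear: "linear (\<lambda>x. Poly_Mapping.lookup x i :: real)"
  by (rule linearI) (simp_all add: lookup_add)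

lemma subspace_coord_space: "subspace (coord_space d)"
  unfolding subspace_def coord_space_def
  by (auto simp: in_keys_iff lookup_add subset_iff) (metis add_0)

lemma coord_space_iff: "x \<in> coord_space d \<longleftrightarrow> (\<forall>i\<ge>d. Poly_Mapping.lookup x i = 0)"
  by (auto simp: coord_space_def in_keys_iff subset_iff) (metis leI)+

definition unit_vecs :: "nat \<Rightarrow> (nat \<Rightarrow>\<^sub>0 real) set" where
  "unit_vecs d = (\<lambda>i. Poly_Mapping.single i 1) ` {..<d}"

lemma coord_space_eq_span: "coord_space d = span (unit_vecs d)"
proof
  show "span (unit_vecs d) \<subseteq> coord_space d"
    by (rule span_minimal[OF _ subspace_coord_space])
      (auto simp: unit_vecs_def coord_space_def)
  show "coord_space d \<subseteq> span (unit_vecs d)"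
  proof
    fix x assume x: "x \<in> coord_space d"
    have "x = (\<Sum>i<d. Poly_Mapping.lookup x i *\<^sub>R Poly_Mapping.single i 1)"
    proof (rule poly_mapping_eqI)
      fix j
      have "Poly_Mapping.lookup (\<Sum>i<d. Poly_Mapping.lookup x i *\<^sub>R Poly_Mapping.single i 1) j
        = (\<Sum>i<d. Poly_Mapping.lookup x i * (1 when i = j))"
        by (simp add: lookup_sum lookup_single)
      also have "\<dots> = (\<Sum>i<d. if i = j then Poly_Mapping.lookup x i else 0)"
        by (rule sum.cong) (auto simp: when_def)
      also have "\<dots> = Poly_Mapping.lookup x j"
        using x by (auto simp: coord_space_iff)
      finally show "Poly_Mapping.lookup x j =
        Poly_Mapping.lookup (\<Sum>i<d. Poly_Mapping.lookup x i *\<^sub>R Poly_Mapping.single i 1) j" by simp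
    qed
    also have "\<dots> \<in> span (unit_vecs d)"
      by (intro span_sum span_scale span_base) (auto simp: unit_vecs_def)
    finally show "x \<in> span (unit_vecs d)" .
  qed
qed

lemma independent_unit_vecs: "independent (unit_vecs d)"
  unfolding dependent_def
proof
  assume "\<exists>a\<in>unit_vecs d. a \<in> span (unit_vecs d - {a})"
  then obtain i where i: "Poly_Mapping.single i 1 \<in> span (unit_vecs d - {Poly_Mapping.single i 1})"
    by (auto simp: unit_vecs_def)
  have "span (unit_vecs d - {Poly_Mapping.single i 1}) \<subseteq> {x. Poly_Mapping.lookup x i = 0}"
    by (rule span_minimal)
      (auto simp: unit_vecs_def subspace_def lookup_add lookup_single when_def)
  then show False using i by (auto simp: lookup_single)
qed

text \<open>
  The origin and the unit vectors form an affine basis of the coordinate space.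
\<close>
lemma affine_dim_eq_of_affine_hull_coord_space:
  assumes "affine hull S = coord_space d"
  shows "affine_dim S = int d"
proof -
  let ?B = "insert 0 (unit_vecs d)"
  have inj: "inj_on (\<lambda>i. Poly_Mapping.single i (1::real)) {..<d}"
    by (rule inj_onI) (metis lookup_single_eq lookup_single_not_eq zero_neq_one)
  have "0 \<notin> unit_vecs d" by (auto simp: unit_vecs_def) (metis lookup_single_eq lookup_zero zero_neq_one)
  then have "card ?B = d + 1" "finite ?B"
    by (auto simp: unit_vecs_def card_image[OF inj])
  moreover have "affine hull ?B = affine hull S"
    using affine_hull_span_0[of ?B] by (simp add: hull_inc span_insert_0 coord_space_eq_span assms)
  moreover have "\<not> affine_dependent ?B"
    using affine_dependent_imp_dependent2 independent_unit_vecs by blast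
  ultimately show ?thesis using affine_dim_eqI[of ?B S] by simp
qed

section \<open>The polytope\<close>

text \<open>
  The identification of \<open>\<real>\<^sup>n \<times> \<real>\<^sup>2\<close> with \<open>coord_space (n + 2)\<close>.  The second factor is the plane of the
  hexagon, the first one contains the fibres over its points.
\<close>
definition point :: "nat \<Rightarrow> (nat \<Rightarrow> real) \<Rightarrow> real \<times> real \<Rightarrow> (nat \<Rightarrow>\<^sub>0 real)" where
  "point n f s =
     Abs_poly_mapping (\<lambda>i. if i < n then f i else if i = n then fst s else if i = Suc n then snd s else 0)"

lemma lookup_point [simp]:
  "Poly_Mapping.lookup (point n f s) i =
     (if i < n then f i else if i = n then fst s else if i = Suc n then snd s else 0)"
proof -
  have "finite {i. (if i < n then f i else if i = n then fst s else if i = Suc n then snd s else 0) \<noteq> 0}"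
    by (rule finite_subset[of _ "{..Suc n}"]) (auto split: if_splits)
  then show ?thesis by (simp add: point_def)
qed

lemma point_eqD:
  assumes "point n f s = point n g t"
  shows "s = t" "i < n \<Longrightarrow> f i = g i"
proof -
  have *: "Poly_Mapping.lookup (point n f s) i = Poly_Mapping.lookup (point n g t) i" for i
    using assms by simp
  show "s = t" using *[of n] *[of "Suc n"] by (simp add: prod_eq_iff)
  show "f i = g i" if "i < n" using *[of i] that by simp
qed

lemma eq_point:
  assumes "x \<in> coord_space (n + 2)"
  shows "x = point n (Poly_Mapping.lookup x) (Poly_Mapping.lookup x n, Poly_Mapping.lookup x (Suc n))"
  using assms by (intro poly_mapping_eqI) (auto simp: coord_space_iff)

text \<open>
  In the centred coordinates \<open>2 t - 1\<close> these six points are the solutions in \<open>{-1, 0, 1}\<^sup>2\<close> of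
  \<open>x\<^sup>2 - x y + y\<^sup>2 = 1\<close>.  The sum of the coordinates takes the values \<open>0\<close>, \<open>1/2\<close>, \<open>3/2\<close>, \<open>2\<close>, so the line
  on which it is \<open>1\<close> passes through no vertex and cuts the hexagon in half.
\<close>
definition hexagon :: "(real \<times> real) set" where
  "hexagon = {(0, 0), (1/2, 0), (1, 1/2), (1, 1), (1/2, 1), (0, 1/2)}"

definition cube :: "nat \<Rightarrow> (nat \<Rightarrow> real) set" where
  "cube n = {..<n} \<rightarrow>\<^sub>E {0, 1}"

text \<open>
  After centring at \<open>(1/2, ..., 1/2)\<close> these are the points of \<open>{-1/2, 0, 1/2}\<^sup>n\<close> on the sphere with squared
  radius \<open>k / 4\<close>.
\<close>
definition sphere_points :: "nat \<Rightarrow> nat \<Rightarrow> (nat \<Rightarrow> real) set" where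
  "sphere_points n k = {f \<in> {..<n} \<rightarrow>\<^sub>E {0, 1/2, 1}. card {i \<in> {..<n}. f i \<noteq> 1/2} = k}"

text \<open>
  The two opposite corners \<open>(0, 0)\<close> and \<open>(1, 1)\<close> of the hexagon, one on each side of the cut, carry
  the large vertex sets; the four corners next to the cut carry cubes.
\<close>
definition fibre :: "nat \<Rightarrow> nat \<Rightarrow> real \<times> real \<Rightarrow> (nat \<Rightarrow> real) set" where
  "fibre n k s = (if s \<in> {(0, 0), (1, 1)} then sphere_points n k else cube n)"

definition verts :: "nat \<Rightarrow> nat \<Rightarrow> (nat \<Rightarrow>\<^sub>0 real) set" where
  "verts n k = {point n f s | f s. s \<in> hexagon \<and> f \<in> fibre n k s}"

lemma fibre_values: "f \<in> fibre n k s \<Longrightarrow> i < n \<Longrightarrow> f i \<in> {0, 1/2, 1}"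
  by (auto simp: fibre_def sphere_points_def cube_def PiE_iff split: if_splits)

lemma finite_fibre: "finite (fibre n k s)"
  by (auto simp: fibre_def sphere_points_def cube_def intro!: finite_PiE)

lemma finite_verts: "finite (verts n k)"
proof -
  have "verts n k = (\<lambda>(s, f). point n f s) ` (SIGMA s:hexagon. fibre n k s)"
    by (auto simp: verts_def image_iff)
  then show ?thesis
    by (auto simp: hexagon_def intro!: finite_imageI finite_SigmaI finite_fibre)
qed

lemma verts_subset_coord_space: "verts n k \<subseteq> coord_space (n + 2)"
  by (auto simp: verts_def coord_space_iff)

text \<open>
  If \<open>g\<close> agrees with \<open>f\<close> wherever \<open>f\<close> differs from \<open>1/2\<close>, then it already has \<open>k\<close> coordinates
  different from \<open>1/2\<close> there, and all the others must be \<open>1/2\<close>, as for \<open>f\<close>.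
\<close>
lemma sphere_points_convex_position:
  assumes f: "f \<in> sphere_points n k" and g: "g \<in> sphere_points n k"
    and agree: "\<And>i. i < n \<Longrightarrow> f i \<noteq> 1/2 \<Longrightarrow> g i = f i" and i: "i < n"
  shows "g i = f i"
proof -
  have "{i \<in> {..<n}. f i \<noteq> 1/2} \<subseteq> {i \<in> {..<n}. g i \<noteq> 1/2}"
    using agree by auto
  moreover have "card {i \<in> {..<n}. f i \<noteq> 1/2} = card {i \<in> {..<n}. g i \<noteq> 1/2}"
    using f g by (simp add: sphere_points_def)
  ultimately have "{i \<in> {..<n}. f i \<noteq> 1/2} = {i \<in> {..<n}. g i \<noteq> 1/2}"
    by (intro card_subset_eq) auto
  then have "f i \<noteq> 1/2 \<longleftrightarrow> g i \<noteq> 1/2" using i by blast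
  then show ?thesis using agree[OF i] by fastforce
qed

lemma fibre_convex_position:
  assumes f: "f \<in> fibre n k s" and g: "g \<in> fibre n k s"
    and "i < n" "f i \<noteq> g i"
  shows "\<exists>j<n. f j \<noteq> 1/2 \<and> g j \<noteq> f j"
proof (cases "s \<in> {(0, 0), (1, 1)}")
  case True
  then show ?thesis using sphere_points_convex_position[of f n k g i] assms by (auto simp: fibre_def)
next
  case False
  then have "f i \<in> {0, 1}" using f \<open>i < n\<close> by (auto simp: fibre_def cube_def PiE_iff)
  then have "f i \<noteq> 1/2" by auto
  then show ?thesis using assms(3,4) by metis
qed

text \<open>
  The expression on each side is the inner product with the centred point \<open>(a, b)\<close> for the quadratic form
  \<open>x\<^sup>2 - x y + y\<^sup>2\<close>, up to a factor and a constant.  All six corners have the same length in this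
  form, so the strict Cauchy-Schwarz inequality separates them.
\<close>
lemma hexagon_convex_position:
  assumes "s \<in> hexagon" "t \<in> hexagon" "s \<noteq> t"
  defines "a \<equiv> 2 * fst s - 1" and "b \<equiv> 2 * snd s - 1"
  shows "(2 * a - b) * fst t + (2 * b - a) * snd t < (2 * a - b) * fst s + (2 * b - a) * snd s"
  using assms(1-3) unfolding a_def b_def hexagon_def by auto

text \<open>
  The linear functional \<open>l\<close> has its only maximum at \<open>x\<close>.  On the plane coordinates it exposes the corner \<open>s\<close>,
  and on the first \<open>n\<close> coordinates it has coefficients \<open>2 f i - 1 \<in> {-1, 0, 1}\<close>.  Since every
  \<open>(2 f i - 1) * y\<close> with \<open>y \<in> [0, 1]\<close> is largest at \<open>y = f i\<close>, no vertex exceeds \<open>x\<close> on either part,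
  and a vertex over the same corner is beaten in a coordinate with \<open>f i \<noteq> 1/2\<close> by
  \<open>fibre_convex_position\<close>.
\<close>
lemma verts_extreme:
  assumes "x \<in> verts n k"
  shows "x extreme_point_of (convex hull (verts n k))"
proof -
  obtain f s where x: "x = point n f s" and s: "s \<in> hexagon" and f: "f \<in> fibre n k s"
    using assms by (auto simp: verts_def)
  define a b where "a = 2 * fst s - 1" and "b = 2 * snd s - 1"
  define l where "l = (\<lambda>y. (\<Sum>i<n. (2 * f i - 1) * Poly_Mapping.lookup y i)
    + ((2 * a - b) * Poly_Mapping.lookup y n + (2 * b - a) * Poly_Mapping.lookup y (Suc n)))"
  have "linear l"
    unfolding l_def
    by (rule linearI)
      (simp_all add: lookup_add distrib_left sum.distrib sum_distrib_left mult.left_commute)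
  moreover have "l y < l x" if y: "y \<in> verts n k" and "y \<noteq> x" for y
  proof -
    obtain g t where y: "y = point n g t" and t: "t \<in> hexagon" and g: "g \<in> fibre n k t"
      using y by (auto simp: verts_def)
    have le: "(2 * f i - 1) * g i \<le> (2 * f i - 1) * f i" if "i < n" for i
    proof -
      have fi: "f i = 0 \<or> 2 * f i - 1 = 0 \<or> f i = 1"
        using fibre_values[OF f that] by auto
      show ?thesis
        using fi fibre_values[OF g that] by (elim disjE) auto
    qed
    then have sum_le: "(\<Sum>i<n. (2 * f i - 1) * g i) \<le> (\<Sum>i<n. (2 * f i - 1) * f i)"
      by (intro sum_mono) auto
    have ly: "l y = (\<Sum>i<n. (2 * f i - 1) * g i) + ((2 * a - b) * fst t + (2 * b - a) * snd t)"
      by (simp add: l_def y)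
    have lx: "l x = (\<Sum>i<n. (2 * f i - 1) * f i) + ((2 * a - b) * fst s + (2 * b - a) * snd s)"
      by (simp add: l_def x)
    show ?thesis
    proof (cases "s = t")
      case False
      then show ?thesis
        using hexagon_convex_position[OF s t] sum_le ly lx unfolding a_def b_def by linarith
    next
      case True
      have "\<exists>i<n. f i \<noteq> g i"
      proof (rule ccontr)
        assume "\<not> ?thesis"
        then have "x = y" using True unfolding x y by (intro poly_mapping_eqI) auto
        then show False using \<open>y \<noteq> x\<close> by simp
      qed
      then obtain j where j: "j < n" "f j \<noteq> 1/2" "g j \<noteq> f j"
        using fibre_convex_position f g True by blast
      have "(2 * f j - 1) * g j < (2 * f j - 1) * f j"
        using fibre_values[OF f j(1)] fibre_values[OF g j(1)] j(2,3) by auto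
      then have "(\<Sum>i<n. (2 * f i - 1) * g i) < (\<Sum>i<n. (2 * f i - 1) * f i)"
        using j(1) le by (intro sum_strict_mono_ex1) auto
      then show ?thesis using True ly lx by simp
    qed
  qed
  ultimately show ?thesis
    using assms by (intro extreme_point_of_convex_hull_strict_maximum[of l]) auto
qed

lemma polytope_verts_convex_hull_verts: "polytope_verts (convex hull (verts n k)) = verts n k"
  using verts_extreme extreme_point_of_convex_hull by (auto simp: polytope_verts_def)

section \<open>The middle section\<close>

lemma linear_le_on_convex_hull:
  fixes l :: "'a::real_vector \<Rightarrow> real"
  assumes "linear l" "\<And>v. v \<in> V \<Longrightarrow> l v \<le> c" "w \<in> convex hull V"
  shows "l w \<le> c"
proof -
  have "convex (l -` {..c})"
    using assms(1) by (intro convex_linear_vimage) auto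
  then have "convex hull V \<subseteq> l -` {..c}" using assms(2) by (intro hull_minimal) auto
  then show ?thesis using assms(3) by auto
qed

text \<open>
  The bound \<open>1/2\<close> on the difference of the last two coordinates is what confines the section of the
  hexagon by the line \<open>t\<^sub>1 + t\<^sub>2 = 1\<close> to the segment from \<open>(3/4, 1/4)\<close> to \<open>(1/4, 3/4)\<close>.
\<close>
lemma convex_hull_verts_bounds:
  assumes w: "w \<in> convex hull (verts n k)"
  shows "i < n \<Longrightarrow> 0 \<le> Poly_Mapping.lookup w i \<and> Poly_Mapping.lookup w i \<le> 1"
    and "\<bar>Poly_Mapping.lookup w n - Poly_Mapping.lookup w (Suc n)\<bar> \<le> 1/2"
    and "w \<in> coord_space (n + 2)"
proof -
  have lin: "linear (\<lambda>x. Poly_Mapping.lookup x i - Poly_Mapping.lookup x j :: real)"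
    "linear (\<lambda>x. - Poly_Mapping.lookup x i :: real)" for i j :: nat
    by (rule linearI; simp add: lookup_add algebra_simps)+
  show "0 \<le> Poly_Mapping.lookup w i \<and> Poly_Mapping.lookup w i \<le> 1" if "i < n"
  proof
    have v: "0 \<le> Poly_Mapping.lookup v i \<and> Poly_Mapping.lookup v i \<le> 1" if "v \<in> verts n k" for v
      using that \<open>i < n\<close> fibre_values[OF _ \<open>i < n\<close>, of _ k] by (fastforce simp: verts_def)
    show "Poly_Mapping.lookup w i \<le> 1"
      using linear_le_on_convex_hull[OF lookup_linear _ w] v by blast
    have "- Poly_Mapping.lookup w i \<le> 0"
      by (rule linear_le_on_convex_hull[OF lin(2) _ w]) (use v in simp)
    then show "0 \<le> Poly_Mapping.lookup w i" by simp
  qed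
  have "Poly_Mapping.lookup v n - Poly_Mapping.lookup v (Suc n) \<le> 1/2"
    "Poly_Mapping.lookup v (Suc n) - Poly_Mapping.lookup v n \<le> 1/2" if "v \<in> verts n k" for v
    using that by (auto simp: verts_def hexagon_def)
  then have "Poly_Mapping.lookup w n - Poly_Mapping.lookup w (Suc n) \<le> 1/2"
    and "Poly_Mapping.lookup w (Suc n) - Poly_Mapping.lookup w n \<le> 1/2"
    using linear_le_on_convex_hull[OF lin(1) _ w] by blast+
  then show "\<bar>Poly_Mapping.lookup w n - Poly_Mapping.lookup w (Suc n)\<bar> \<le> 1/2" by linarith
  show "w \<in> coord_space (n + 2)"
    using w hull_minimal[of "verts n k" "coord_space (n + 2)" convex, OF verts_subset_coord_space]
      subspace_imp_convex[OF subspace_coord_space] by blast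
qed

text \<open>
  Every point of the unit cube is a convex combination of its vertices.  The induction releases one coordinate at a
  time: the first \<open>m\<close> coordinates are arbitrary in \<open>[0, 1]\<close>, the others are \<open>0\<close> or \<open>1\<close>.
\<close>
lemma point_in_convex_if_cube:
  assumes "convex K" and cube: "\<And>c. c \<in> cube n \<Longrightarrow> point n c s \<in> K"
    and "\<And>i. i < n \<Longrightarrow> 0 \<le> f i \<and> f i \<le> 1"
  shows "point n f s \<in> K"
proof -
  have "point n f s \<in> K"
    if "m \<le> n" "\<And>i. i < n \<Longrightarrow> 0 \<le> f i \<and> f i \<le> 1" "\<And>i. m \<le> i \<Longrightarrow> i < n \<Longrightarrow> f i \<in> {0, 1}" for m f
    using that
  proof (induction m arbitrary: f)
    case 0
    then have "restrict f {..<n} \<in> cube n" by (auto simp: cube_def)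
    moreover have "point n (restrict f {..<n}) s = point n f s"
      by (rule poly_mapping_eqI) auto
    ultimately show ?case using cube by metis
  next
    case (Suc m)
    have "point n (f(m := e)) s \<in> K" if "e \<in> {0, 1}" for e
    proof (rule Suc.IH)
      fix i assume "m \<le> i" "i < n"
      then show "(f(m := e)) i \<in> {0, 1}"
        using that Suc.prems(3)[of i] by (cases "i = m") auto
    qed (use Suc.prems that in auto)
    then have "(1 - f m) *\<^sub>R point n (f(m := 0)) s + f m *\<^sub>R point n (f(m := 1)) s \<in> K"
      using Suc.prems(1,2) \<open>convex K\<close> by (intro convexD) auto
    also have "(1 - f m) *\<^sub>R point n (f(m := 0)) s + f m *\<^sub>R point n (f(m := 1)) s = point n f s"
      using Suc.prems(1) by (intro poly_mapping_eqI, simp add: lookup_add) (auto simp: algebra_simps)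
    finally show ?case .
  qed
  from this[of n f] show ?thesis using assms(3) by simp
qed

lemma point_combination:
  "(1 - t) *\<^sub>R point n f a + t *\<^sub>R point n f b = point n f ((1 - t) *\<^sub>R a + t *\<^sub>R b)"
  by (rule poly_mapping_eqI, simp add: lookup_add) (auto simp: algebra_simps)

text \<open>
  The two edges of the hexagon that cross the line \<open>t\<^sub>1 + t\<^sub>2 = 1\<close>.
\<close>
definition bridges :: "((real \<times> real) \<times> (real \<times> real)) set" where
  "bridges = {((1/2, 0), (1, 1/2)), ((0, 1/2), (1/2, 1))}"

definition bridge_midpoints :: "nat \<Rightarrow> (nat \<Rightarrow>\<^sub>0 real) set" where
  "bridge_midpoints n =
     {midpoint (point n c a) (point n c b) | c a b. c \<in> cube n \<and> (a, b) \<in> bridges}"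

lemma bridge_ends_verts:
  assumes "c \<in> cube n" "(a, b) \<in> bridges"
  shows "point n c a \<in> verts n k" "point n c b \<in> verts n k" "point n c a \<noteq> point n c b"
proof -
  have hex: "a \<in> hexagon - {(0, 0), (1, 1)}" "b \<in> hexagon - {(0, 0), (1, 1)}"
    using assms(2) by (auto simp: bridges_def hexagon_def)
  then have "fibre n k a = cube n" "fibre n k b = cube n" by (auto simp: fibre_def)
  then show "point n c a \<in> verts n k" "point n c b \<in> verts n k"
    using hex assms(1) unfolding verts_def by blast+
  have "a \<noteq> b" using assms(2) by (auto simp: bridges_def)
  then show "point n c a \<noteq> point n c b" using point_eqD(1) by blast
qed

text \<open>
  The section is the product of the unit cube and the segment between the midpoints \<open>(3/4, 1/4)\<close> and
  \<open>(1/4, 3/4)\<close> of the two bridges.  Only the cube bounds the first \<open>n\<close> coordinates, so the large fibres leave no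
  trace in its vertices.
\<close>
lemma middle_section_subset:
  assumes w: "w \<in> convex hull (verts n k)"
    and sec: "Poly_Mapping.lookup w n + Poly_Mapping.lookup w (Suc n) = 1"
  shows "w \<in> convex hull (bridge_midpoints n)"
proof -
  let ?K = "convex hull (bridge_midpoints n)"
  have mid: "midpoint (point n c a) (point n c b) = point n c (midpoint a b)" for c a b
    using point_combination[of "1/2" n c a b] by (simp add: midpoint_def scaleR_add_right)
  let ?f = "Poly_Mapping.lookup w"
  have f: "\<And>i. i < n \<Longrightarrow> 0 \<le> ?f i \<and> ?f i \<le> 1"
    using convex_hull_verts_bounds(1)[OF w] .
  have base: "point n ?f (midpoint a b) \<in> ?K" if "(a, b) \<in> bridges" for a b
  proof (rule point_in_convex_if_cube[OF convex_convex_hull _ f])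
    fix c assume "c \<in> cube n"
    then have "midpoint (point n c a) (point n c b) \<in> bridge_midpoints n"
      using that unfolding bridge_midpoints_def by blast
    then show "point n c (midpoint a b) \<in> ?K" by (simp add: mid hull_inc)
  qed
  have ends: "point n ?f (3/4, 1/4) \<in> ?K" "point n ?f (1/4, 3/4) \<in> ?K"
    using base[of "(1/2, 0)" "(1, 1/2)"] base[of "(0, 1/2)" "(1/2, 1)"]
    by (simp_all add: bridges_def midpoint_def)
  \<comment> \<open>\<open>t\<close> is the position of the last two coordinates on the segment between the midpoints.\<close>
  define t where "t = 3/2 - 2 * ?f n"
  have t: "0 \<le> t" "t \<le> 1"
    using convex_hull_verts_bounds(2)[OF w] sec unfolding t_def by linarith+
  have "(1 - t) *\<^sub>R point n ?f (3/4, 1/4) + t *\<^sub>R point n ?f (1/4, 3/4) \<in> ?K"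
    using t ends by (intro convexD[OF convex_convex_hull]) auto
  moreover have "(1 - t) *\<^sub>R (3/4, 1/4) + t *\<^sub>R (1/4, 3/4) = (?f n, ?f (Suc n))"
    using sec by (simp add: t_def field_simps)
  ultimately show ?thesis
    using eq_point[OF convex_hull_verts_bounds(3)[OF w]] point_combination by metis
qed

section \<open>Few edges cross the middle section\<close>

definition lower :: "nat \<Rightarrow> nat \<Rightarrow> (nat \<Rightarrow>\<^sub>0 real) set" where
  "lower n k = {x \<in> verts n k. Poly_Mapping.lookup x n + Poly_Mapping.lookup x (Suc n) < 1}"

text \<open>
  The edge meets the section in a point \<open>w\<close>, a convex combination of midpoints of bridges.  The face \<open>F\<close> contains
  \<open>w\<close>, hence one of these midpoints, hence both ends of that bridge.  These are vertices, and the edge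
  contains only two vertices.
\<close>
lemma crossing_edge_is_bridge:
  assumes u: "u \<in> lower n k" and v: "v \<in> verts n k - lower n k"
    and F: "F face_of (convex hull (verts n k))" "affine_dim F = 1" "u \<in> F" "v \<in> F"
  shows "\<exists>c\<in>cube n. \<exists>(a, b)\<in>bridges. {u, v} = {point n c a, point n c b}"
proof -
  let ?P = "convex hull (verts n k)"
  let ?h = "\<lambda>x. Poly_Mapping.lookup x n + Poly_Mapping.lookup x (Suc n) :: real"
  have hu: "?h u < 1" using u by (simp add: lower_def)
  \<comment> \<open>No vertex has height exactly \<open>1\<close>.\<close>
  have hv: "?h v > 1" using v by (auto simp: lower_def verts_def hexagon_def)
  define t where "t = (1 - ?h u) / (?h v - ?h u)"
  have t: "0 \<le> t" "t \<le> 1" using hu hv by (auto simp: t_def)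
  define w where "w = (1 - t) *\<^sub>R u + t *\<^sub>R v"
  have "convex F" using F(1) face_of_imp_convex by blast
  then have wF: "w \<in> F" unfolding w_def using F(3,4) t by (intro convexD) auto
  have "t * (?h v - ?h u) = 1 - ?h u" using hu hv by (simp add: t_def)
  moreover have "?h w = ?h u + t * (?h v - ?h u)"
    unfolding w_def lookup_add lookup_scaleR real_scaleR_def by (simp only: algebra_simps)
  ultimately have hw: "?h w = 1" by simp
  have wP: "w \<in> ?P" using wF F(1) face_of_imp_subset by blast
  have ends: "point n c a \<in> ?P" "point n c b \<in> ?P" if "c \<in> cube n" "(a, b) \<in> bridges" for a b c
    using bridge_ends_verts[OF that] by (auto intro: hull_inc)
  have midP: "bridge_midpoints n \<subseteq> ?P"
    unfolding bridge_midpoints_def midpoint_def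
    using ends by (auto simp: scaleR_add_right intro!: convexD[OF convex_convex_hull])
  obtain q where q: "q \<in> bridge_midpoints n" "q \<in> F"
    using face_meets_generators[OF F(1) convex_convex_hull midP wF middle_section_subset[OF wP hw]] .
  then obtain c a b where c: "c \<in> cube n" and ab: "(a, b) \<in> bridges"
    and qe: "q = midpoint (point n c a) (point n c b)"
    by (auto simp: bridge_midpoints_def)
  note V = bridge_ends_verts(1,2)[OF c ab, of k] bridge_ends_verts(3)[OF c ab]
  have "q \<in> open_segment (point n c a) (point n c b)"
    using V(3) by (simp add: qe)
  then have inF: "point n c a \<in> F" "point n c b \<in> F"
    using F(1) q(2) ends[OF c ab] unfolding face_of_def by blast+
  have "?P \<subseteq> span (unit_vecs (n + 2))"
    using convex_hull_verts_bounds(3) coord_space_eq_span by blast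
  moreover have "finite (unit_vecs (n + 2))" by (simp add: unit_vecs_def)
  moreover have "u \<noteq> v" using u v by auto
  moreover have "u \<in> verts n k" "v \<in> verts n k" using u v by (auto simp: lower_def)
  ultimately have "{u, v} = {point n c a, point n c b}"
    using edge_determined_by_extreme_points[OF F(1), of "unit_vecs (n + 2)" u v "point n c a" "point n c b"]
      verts_extreme[of _ n k] F inF V by simp
  then show ?thesis using c ab by blast
qed

lemma card_edge_boundary_lower:
  "card (edge_boundary (verts n k) (polytope_edges (convex hull (verts n k))) (lower n k)) \<le> 2 * 2 ^ n"
proof -
  let ?e = "\<lambda>(c, a, b). {point n c a, point n c b}"
  let ?B = "edge_boundary (verts n k) (polytope_edges (convex hull (verts n k))) (lower n k)"
  have fin: "finite (cube n \<times> bridges)"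
    by (auto simp: cube_def bridges_def intro!: finite_PiE finite_cartesian_product)
  have "?B \<subseteq> ?e ` (cube n \<times> bridges)"
  proof
    fix e assume "e \<in> ?B"
    then obtain u v u' v' F where e: "e = {u, v}" "u \<in> lower n k" "v \<in> verts n k - lower n k"
      and "e = {u', v'}" and F: "F face_of (convex hull (verts n k))" "affine_dim F = 1" "u' \<in> F" "v' \<in> F"
      unfolding edge_boundary_def polytope_edges_def by blast
    then have "u \<in> F" "v \<in> F" by (auto simp: doubleton_eq_iff)
    then obtain c a b where "c \<in> cube n" "(a, b) \<in> bridges" "{u, v} = {point n c a, point n c b}"
      using crossing_edge_is_bridge[OF e(2,3) F(1,2)] by blast
    then show "e \<in> ?e ` (cube n \<times> bridges)"
      by (auto simp: e(1) intro!: image_eqI[of _ _ "(c, a, b)"])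
  qed
  then have "card ?B \<le> card (cube n \<times> bridges)"
    using fin surj_card_le by blast
  also have "\<dots> = 2 * 2 ^ n"
    by (simp add: card_cartesian_product cube_def card_PiE bridges_def numeral_2_eq_2)
  finally show ?thesis .
qed

section \<open>Expansion of the polytope\<close>

lemma card_sphere_points_le:
  "card (sphere_points n k) \<le> card (lower n k)"
  "card (sphere_points n k) \<le> card (verts n k - lower n k)"
proof -
  have inj: "inj_on (\<lambda>f. point n f s) (sphere_points n k)" for s
  proof (rule inj_onI)
    fix f g assume fg: "f \<in> sphere_points n k" "g \<in> sphere_points n k" and "point n f s = point n g s"
    then have "f i = g i" if "i < n" for i using point_eqD(2) that by blast
    then show "f = g"
      using fg by (intro PiE_ext[of f "{..<n}" "\<lambda>_. {0, 1/2, 1}" g]) (auto simp: sphere_points_def)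
  qed
  have sub: "(\<lambda>f. point n f s) ` sphere_points n k \<subseteq> verts n k" if "s \<in> {(0, 0), (1, 1)}" for s
  proof -
    have "s \<in> hexagon" "fibre n k s = sphere_points n k" using that by (auto simp: hexagon_def fibre_def)
    then show ?thesis unfolding verts_def by blast
  qed
  have "(\<lambda>f. point n f (0, 0)) ` sphere_points n k \<subseteq> lower n k"
    using sub[of "(0, 0)"] by (auto simp: lower_def)
  then show "card (sphere_points n k) \<le> card (lower n k)"
    using card_inj_on_le[OF inj] finite_subset[OF _ finite_verts[of n k], of "lower n k"]
    by (auto simp: lower_def)
  have "(\<lambda>f. point n f (1, 1)) ` sphere_points n k \<subseteq> verts n k - lower n k"
    using sub[of "(1, 1)"] by (auto simp: lower_def)
  then show "card (sphere_points n k) \<le> card (verts n k - lower n k)"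
    using card_inj_on_le[OF inj] finite_verts[of n k] by auto
qed

lemma graph_expansion_le:
  assumes "finite V" "S \<subseteq> V" "S \<noteq> {}" "S \<noteq> V"
  shows "graph_expansion V E \<le> real (card (edge_boundary V E S)) / real (min (card S) (card (V - S)))"
  unfolding graph_expansion_def
proof (rule Min_le)
  let ?r = "\<lambda>S. real (card (edge_boundary V E S)) / real (min (card S) (card (V - S)))"
  have "{?r S | S. S \<subseteq> V \<and> S \<noteq> {} \<and> S \<noteq> V} \<subseteq> ?r ` Pow V" by auto
  then show "finite {?r S | S. S \<subseteq> V \<and> S \<noteq> {} \<and> S \<noteq> V}"
    using assms(1) by (auto intro: finite_subset)
qed (use assms in blast)

lemma polytope_expansion_verts_le:
  assumes "sphere_points n k \<noteq> {}"
  shows "polytope_expansion (convex hull (verts n k)) \<le> 2 * 2 ^ n / card (sphere_points n k)"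
proof -
  let ?V = "verts n k" and ?S = "lower n k" and ?E = "polytope_edges (convex hull (verts n k))"
  have "finite (sphere_points n k)"
    using finite_fibre[of n k "(0, 0)"] by (simp add: fibre_def)
  then have pos: "card (sphere_points n k) > 0" using assms by (simp add: card_gt_0_iff)
  then have "card ?S \<noteq> 0" "card (?V - ?S) \<noteq> 0"
    using card_sphere_points_le[of n k] by simp_all
  then have "?S \<noteq> {}" "?V - ?S \<noteq> {}" by (metis card.empty)+
  moreover have "?S \<subseteq> ?V" by (auto simp: lower_def)
  ultimately have "polytope_expansion (convex hull ?V) \<le>
      real (card (edge_boundary ?V ?E ?S)) / real (min (card ?S) (card (?V - ?S)))"
    unfolding polytope_expansion_def polytope_verts_convex_hull_verts
    by (intro graph_expansion_le finite_verts) auto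
  also have "\<dots> \<le> real (2 * 2 ^ n) / real (card (sphere_points n k))"
    using card_edge_boundary_lower[of n k] card_sphere_points_le[of n k] pos
    by (intro frac_le of_nat_mono) auto
  finally show ?thesis by simp
qed

text \<open>
  The origin is an affine combination of the vertices over \<open>(1/2, 0)\<close>, \<open>(0, 1/2)\<close> and \<open>(1, 1/2)\<close> with zeros
  in the first \<open>n\<close> coordinates, so the affine hull is a linear span.  It remains to write the
  unit vectors in terms of vertices over these corners.
\<close>
lemma affine_hull_verts: "affine hull (verts n k) = coord_space (n + 2)"
proof
  show "affine hull (verts n k) \<subseteq> coord_space (n + 2)"
    using verts_subset_coord_space subspace_imp_affine[OF subspace_coord_space]
    by (rule hull_minimal)
next
  define z where "z = restrict (\<lambda>_. 0 :: real) {..<n}"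
  have c: "restrict (\<lambda>j. if j = i then 1 else 0) {..<n} \<in> cube n" "z \<in> cube n" for i
    by (auto simp: cube_def z_def)
  have V: "point n f s \<in> verts n k" if "f \<in> cube n" "s \<in> {(1/2, 0), (0, 1/2), (1, 1/2)}" for f s
  proof -
    have "s \<in> hexagon" "fibre n k s = cube n" using that(2) by (auto simp: hexagon_def fibre_def)
    then show ?thesis using that(1) unfolding verts_def by blast
  qed
  have "1 *\<^sub>R point n z (1/2, 0) + (1/2) *\<^sub>R point n z (0, 1/2) + (-1/2) *\<^sub>R point n z (1, 1/2)
      \<in> affine hull (verts n k)"
    using V[OF c(2)] by (intro mem_affine_3 affine_affine_hull hull_inc) auto
  also have "1 *\<^sub>R point n z (1/2, 0) + (1/2) *\<^sub>R point n z (0, 1/2) + (-1/2) *\<^sub>R point n z (1, 1/2) = 0"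
    by (rule poly_mapping_eqI, simp only: lookup_add lookup_scaleR lookup_point) (auto simp: z_def)
  finally have hull: "affine hull (verts n k) = span (verts n k)"
    by (rule affine_hull_span_0)
  have "Poly_Mapping.single i 1 \<in> span (verts n k)" if "i < n + 2" for i
  proof -
    consider "i = n" | "i = Suc n" | "i < n" using \<open>i < n + 2\<close> by linarith
    then show ?thesis
    proof cases
      case 1
      have "Poly_Mapping.single i 1 = 2 *\<^sub>R point n z (1/2, 0)"
        using 1 by (intro poly_mapping_eqI) (auto simp: lookup_single when_def z_def)
      then show ?thesis using V[OF c(2)] by (simp add: span_scale span_base)
    next
      case 2
      have "Poly_Mapping.single i 1 = 2 *\<^sub>R point n z (0, 1/2)"
        using 2 by (intro poly_mapping_eqI) (auto simp: lookup_single when_def z_def)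
      then show ?thesis using V[OF c(2)] by (simp add: span_scale span_base)
    next
      case 3
      have "Poly_Mapping.single i 1 =
          point n (restrict (\<lambda>j. if j = i then 1 else 0) {..<n}) (1/2, 0) - point n z (1/2, 0)"
        using 3 by (intro poly_mapping_eqI) (auto simp: lookup_single lookup_minus when_def z_def)
      then show ?thesis using V c by (simp add: span_diff span_base)
    qed
  qed
  then have "unit_vecs (n + 2) \<subseteq> span (verts n k)" by (auto simp: unit_vecs_def)
  then have "span (unit_vecs (n + 2)) \<subseteq> span (verts n k)" by (intro span_minimal) auto
  then show "coord_space (n + 2) \<subseteq> affine hull (verts n k)"
    by (simp add: hull coord_space_eq_span)
qed

lemma half_integral_polytope_convex_hull_verts:
  "half_integral_polytope (n + 2) (convex hull (verts n k))"
  unfolding half_integral_polytope_def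
proof (intro conjI allI impI)
  show "polytope (convex hull (verts n k))" using finite_verts by (auto simp: polytope_def)
  show "convex hull (verts n k) \<subseteq> coord_space (n + 2)" using convex_hull_verts_bounds(3) by blast
next
  fix v i assume "v extreme_point_of convex hull (verts n k)" "i < n + 2"
  then have "v \<in> verts n k" by (simp add: extreme_point_of_convex_hull)
  then obtain f s where "v = point n f s" "s \<in> hexagon" "f \<in> fibre n k s" by (auto simp: verts_def)
  then show "Poly_Mapping.lookup v i \<in> {0, 1/2, 1}"
    using fibre_values[of f n k s i] by (auto simp: hexagon_def)
qed

text \<open>
  The spheres with \<open>k = 0, ..., n\<close> partition the \<open>3\<^sup>n\<close> points of \<open>{0, 1/2, 1}\<^sup>n\<close>,
  so the largest one has at least the average size.
\<close>
lemma exists_large_sphere: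
  obtains k where "3 ^ n \<le> (n + 1) * card (sphere_points n k)"
proof -
  let ?T = "{..<n} \<rightarrow>\<^sub>E {0, 1/2, 1::real}"
  have "?T = (\<Union>k\<in>{..n}. sphere_points n k)"
  proof -
    have "card {i \<in> {..<n}. f i \<noteq> 1/2} \<le> n" for f :: "nat \<Rightarrow> real"
      using card_mono[of "{..<n}" "{i \<in> {..<n}. f i \<noteq> 1/2}"] by auto
    then show ?thesis unfolding sphere_points_def by blast
  qed
  moreover have "card ?T = 3 ^ n" by (simp add: card_PiE numeral_3_eq_3)
  ultimately have "3 ^ n \<le> (\<Sum>k\<le>n. card (sphere_points n k))"
    using card_UN_le[of "{..n}" "sphere_points n"] by simp
  have "\<exists>k. 3 ^ n \<le> (n + 1) * card (sphere_points n k)"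
  proof (rule ccontr)
    assume "\<not> ?thesis"
    then have "(\<Sum>k\<le>n. (n + 1) * card (sphere_points n k)) < (\<Sum>k\<le>n. 3 ^ n)"
      by (intro sum_strict_mono) (auto simp: not_le)
    then have "(n + 1) * (\<Sum>k\<le>n. card (sphere_points n k)) < (n + 1) * 3 ^ n"
      by (simp add: sum_distrib_left)
    then show False using \<open>3 ^ n \<le> _\<close> by (metis mult_le_mono2 not_le)
  qed
  then show ?thesis using that by blast
qed

theorem theorem1p1:
  fixes N :: nat
  assumes "N \<ge> 1"
  shows "\<exists>d\<ge>N. \<exists>P :: (nat \<Rightarrow>\<^sub>0 real) set.
           half_integral_polytope d P \<and> affine_dim P = int d \<and>
           polytope_expansion P < real d / (sqrt 2) ^ d"
proof -
  \<comment> \<open>The shift by \<open>24\<close> gives \<open>4 \<le> 1 + m / 8 \<le> (9 / 8)\<^sup>m\<close>, and an even \<open>n\<close> keeps the power of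
    \<open>sqrt 2\<close> rational.\<close>
  define m where "m = N + 24"
  define n where "n = 2 * m"
  obtain k where k: "3 ^ n \<le> (n + 1) * card (sphere_points n k)"
    using exists_large_sphere .
  define P where "P = convex hull (verts n k)"
  define A where "A = real (card (sphere_points n k))"
  have "real (3 ^ n) \<le> real ((n + 1) * card (sphere_points n k))" using k of_nat_mono by blast
  then have A: "9 ^ m \<le> (real n + 1) * A"
    by (simp add: A_def n_def power_mult distrib_right)
  have "A > 0"
    using k unfolding A_def by (cases "card (sphere_points n k) = 0") auto
  have "4 \<le> 1 + real m * (1/8)" by (simp add: m_def)
  also have "\<dots> \<le> (1 + 1/8) ^ m" by (rule Bernoulli_inequality) simp
  finally have "4 * 8 ^ m \<le> (9::real) ^ m" by (simp add: power_divide field_simps)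
  also have "\<dots> < (real n + 2) * A" using A \<open>A > 0\<close> by (simp add: algebra_simps)
  finally have "4 * 8 ^ m < (real n + 2) * A" .
  moreover have "(2::real) ^ n * 2 ^ m = 8 ^ m"
    by (simp add: n_def power_mult flip: power_mult_distrib)
  ultimately have "2 * 2 ^ n / A < (real n + 2) / 2 ^ (m + 1)"
    using \<open>A > 0\<close> by (simp add: field_simps)
  moreover have "sphere_points n k \<noteq> {}" using \<open>A > 0\<close> by (auto simp: A_def)
  then have "polytope_expansion P \<le> 2 * 2 ^ n / A"
    unfolding P_def A_def by (rule polytope_expansion_verts_le)
  moreover have "(sqrt 2) ^ (n + 2) = 2 ^ (m + 1)"
    using power_mult[of "sqrt 2" 2 "m + 1"] by (simp add: n_def)
  ultimately have "polytope_expansion P < real (n + 2) / (sqrt 2) ^ (n + 2)"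
    by (metis le_less_trans of_nat_add of_nat_numeral)
  moreover have "affine_dim P = int (n + 2)"
    by (rule affine_dim_eq_of_affine_hull_coord_space) (simp add: P_def affine_hull_verts)
  moreover have "half_integral_polytope (n + 2) P"
    unfolding P_def by (rule half_integral_polytope_convex_hull_verts)
  moreover have "n + 2 \<ge> N" by (simp add: n_def m_def)
  ultimately show ?thesis by blast
qed

end
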